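(* One has $$\mathrm{VMO}_{\Delta_N}(\mathbb{R}^n)=\big\{f\in\mathcal{M}(\mathbb{R}^n): f_+\in\mathrm{VMO}_{\Delta_{N_+}}(\mathbb{R}^n_+)\text{ and }f_-\in\mathrm{VMO}_{\Delta_{N_-}}(\mathbb{R}^n_-)\big\}.$$ Moreover, $$\|f\|_{\mathrm{VMO}_{\Delta_N}(\mathbb{R}^n)}\simeq\|f_+\|_{\mathrm{VMO}_{\Delta_{N_+}}(\mathbb{R}^n_+)}+\|f_-\|_{\mathrm{VMO}_{\Delta_{N_-}}(\mathbb{R}^n_-)},$$ where $\simeq$ means two-sided inequalities with constants independent of $f$.
   Context: Notation. $x=(x',x_n)\in\mathbb{R}^{n-1}\times\mathbb{R}$; $\mathbb{R}^n_\pm=\{x:\pm x_n>0\}$; $f_\pm=f|_{\mathbb{R}^n_\pm}$; $H(t)=1$ for $t\ge 0$ and $H(t)=0$ for $t<0$. Cubes have sides parallel to the axes, $\ell(Q)$ is the side length of $Q$, and $Q(0,r)$ is the cube centered at $0$ with side length $r$. Operators. $\Delta_{N_\pm}$ is the (positive self-adjoint) Neumann Laplacian on $\mathbb{R}^n_\pm$; its semigroup is $e^{-t\Delta_{N_\pm}}f(x)=\int_{\mathbb{R}^n_\pm}p_{t,\Delta_{N_\pm}}(x,y)f(y)dy$ with $$p_{t,\Delta_{N_\pm}}(x,y)=(4\pi t)^{-n/2}e^{-|x'-y'|^2/(4t)}\Big(e^{-|x_n-y_n|^2/(4t)}+e^{-|x_n+y_n|^2/(4t)}\Big),\quad x,y\in\mathbb{R}^n_\pm.$$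 $\Delta_N$ is the positive self-adjoint operator on $L^2(\mathbb{R}^n)$ with $(\Delta_Nf)_\pm=\Delta_{N_\pm}f_\pm$; its heat kernel $p_{t,\Delta_N}(x,y)$ is given by the same formula multiplied by $H(x_ny_n)$, so $(e^{-t\Delta_N}f)_\pm=e^{-t\Delta_{N_\pm}}f_\pm$. Spaces. For $\Omega\subseteq\mathbb{R}^n$ open, $\mathcal{M}(\Omega)$ is the set of $f\in L^1_{loc}(\Omega)$ for which there is $\epsilon>0$ with $\int_\Omega\frac{|f(x)|^2}{1+|x|^{n+\epsilon}}dx<\infty$. For $(L,\Omega)\in\{(\Delta_N,\mathbb{R}^n),(\Delta_{N_+},\mathbb{R}^n_+),(\Delta_{N_-},\mathbb{R}^n_-)\}$, $\mathrm{BMO}_L(\Omega)$ is the set of $f\in\mathcal{M}(\Omega)$ with $\|f\|_{\mathrm{BMO}_L(\Omega)}:=\sup_{Q\subseteq\Omega}\frac{1}{|Q|}\int_Q|f-e^{-\ell(Q)^2L}f|dx<\infty$. $\mathrm{VMO}_L(\Omega)$ is the set of $f\in\mathrm{BMO}_L(\Omega)$ such that, with $\mathcal{O}_L(f,Q)=\big(\frac{1}{|Q|}\int_Q|f-e^{-\ell(Q)^2L}f|^2dx\big)^{1/2}$, $$\lim_{r\to0}\sup_{Q\subseteq\Omega,\,\ell(Q)\le r}\mathcal{O}_L(f,Q)=0,\quad\lim_{r\to\infty}\sup_{Q\subseteq\Omega,\,\ell(Q)\ge r}\mathcal{O}_L(f,Q)=0,\quad\lim_{r\to\infty}\sup_{Q\subseteq\Omega\cap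 Q(0,r)^c}\mathcal{O}_L(f,Q)=0;$$ it carries the norm of $\mathrm{BMO}_L(\Omega)$. *)

theory Defs
  imports "HOL-Analysis.Analysis"
begin

text \<open>
  Points of \<open>n\<close>-dimensional space have type \<^typ>\<open>real^'n\<close>, with \<open>n = CARD('n)\<close>.  The type \<^typ>\<open>'n\<close>
  carries no order, so the distinguished (``last'') coordinate \<open>x\<^sub>n\<close> is \<open>x $ k\<close> for a parameter
  \<open>k\<close>, and \<open>x'\<close> consists of the coordinates \<open>x $ i\<close> with \<open>i \<noteq> k\<close>.

  A function on \<open>\<Omega>\<close> is represented by a total function of which only the values on \<open>\<Omega>\<close> are used.
\<close>

definition upper_half :: "'n::finite \<Rightarrow> (real^'n) set" where
  "upper_half k = {x. x $ k > 0}"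

definition lower_half :: "'n::finite \<Rightarrow> (real^'n) set" where
  "lower_half k = {x. x $ k < 0}"

definition heaviside :: "real \<Rightarrow> real" where
  "heaviside t = (if t \<ge> 0 then 1 else 0)"


text \<open>
  The kernel of \<open>e\<^bsup>-t\<Delta>\<^esup>\<close> for the Neumann Laplacian on either half-space (the same formula for
  both), and the one on the whole space for the direct sum of the two.
\<close>

definition neumann_half_kernel ::
    "'n::finite \<Rightarrow> real \<Rightarrow> real^'n \<Rightarrow> real^'n \<Rightarrow> real" where
  "neumann_half_kernel k t x y =
     (4 * pi * t) powr (- real CARD('n) / 2)
     * exp (- (\<Sum>i\<in>UNIV - {k}. (x $ i - y $ i)\<^sup>2) / (4 * t))
     * (exp (- \<bar>x $ k - y $ k\<bar>\<^sup>2 / (4 * t)) + exp (- \<bar>x $ k + y $ k\<bar>\<^sup>2 / (4 * t)))"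

definition neumann_kernel ::
    "'n::finite \<Rightarrow> real \<Rightarrow> real^'n \<Rightarrow> real^'n \<Rightarrow> real" where
  "neumann_kernel k t x y = neumann_half_kernel k t x y * heaviside (x $ k * y $ k)"


text \<open>
  An operator \<open>L\<close> on \<open>\<Omega>\<close> enters the spaces below only through the heat kernel \<open>p\<close> of its
  semigroup, which is what makes \<open>e\<^bsup>-tL\<^esup>f\<close> meaningful for \<open>f\<close> outside \<open>L\<^sup>2\<close>.
\<close>

definition heat_semigroup ::
    "(real^'n) set \<Rightarrow> (real \<Rightarrow> real^'n \<Rightarrow> real^'n \<Rightarrow> real) \<Rightarrow> real
      \<Rightarrow> (real^'n \<Rightarrow> complex) \<Rightarrow> real^'n \<Rightarrow> complex" where
  "heat_semigroup \<Omega> p t f x = (LINT y:\<Omega>|lebesgue. p t x y *\<^sub>R f y)"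

definition L1_loc :: "(real^'n) set \<Rightarrow> (real^'n \<Rightarrow> complex) set" where
  "L1_loc \<Omega> = {f. \<forall>K. compact K \<and> K \<subseteq> \<Omega> \<longrightarrow> set_integrable lebesgue K f}"

definition M_space :: "(real^'n) set \<Rightarrow> (real^'n \<Rightarrow> complex) set" where
  "M_space \<Omega> = {f \<in> L1_loc \<Omega>. \<exists>\<epsilon>>0.
     (\<integral>\<^sup>+x\<in>\<Omega>. ennreal ((norm (f x))\<^sup>2 / (1 + norm x powr (real CARD('n) + \<epsilon>))) \<partial>lebesgue) < \<infinity>}"


text \<open>
  Cubes are taken open, so that cubes inside an open half-space may touch its boundary; averages
  do not see the faces.  A cube \<open>Q\<close> is quantified over as the pair of its centre and its side
  length \<open>\<ell>(Q)\<close>.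
\<close>

definition cube :: "real^'n \<Rightarrow> real \<Rightarrow> (real^'n) set" where
  "cube c l = {x. \<forall>i. \<bar>x $ i - c $ i\<bar> < l / 2}"

definition cubes_in :: "(real^'n) set \<Rightarrow> ((real^'n) \<times> real) set" where
  "cubes_in \<Omega> = {(c, l). l > 0 \<and> cube c l \<subseteq> \<Omega>}"

text \<open>
  Averages, oscillations and suprema are valued in \<^typ>\<open>ennreal\<close>, where they exist unconditionally
  and infinite values are not lost.
\<close>

definition average :: "(real^'n) set \<Rightarrow> (real^'n \<Rightarrow> real) \<Rightarrow> ennreal" where
  "average Q g = (\<integral>\<^sup>+x\<in>Q. ennreal (g x) \<partial>lebesgue) / emeasure lebesgue Q"

definition ennreal_sqrt :: "ennreal \<Rightarrow> ennreal" where
  "ennreal_sqrt a = (if a = \<infinity> then \<infinity> else ennreal (sqrt (enn2real a)))"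

definition BMO_norm ::
    "(real^'n) set \<Rightarrow> (real \<Rightarrow> real^'n \<Rightarrow> real^'n \<Rightarrow> real) \<Rightarrow> (real^'n \<Rightarrow> complex) \<Rightarrow> ennreal" where
  "BMO_norm \<Omega> p f =
     (SUP (c, l) \<in> cubes_in \<Omega>. average (cube c l) (\<lambda>x. norm (f x - heat_semigroup \<Omega> p (l\<^sup>2) f x)))"

definition BMO ::
    "(real^'n) set \<Rightarrow> (real \<Rightarrow> real^'n \<Rightarrow> real^'n \<Rightarrow> real) \<Rightarrow> (real^'n \<Rightarrow> complex) set" where
  "BMO \<Omega> p = {f \<in> M_space \<Omega>. BMO_norm \<Omega> p f < \<infinity>}"

definition osc ::
    "(real^'n) set \<Rightarrow> (real \<Rightarrow> real^'n \<Rightarrow> real^'n \<Rightarrow> real) \<Rightarrow> (real^'n \<Rightarrow> complex)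
      \<Rightarrow> real^'n \<Rightarrow> real \<Rightarrow> ennreal" where
  "osc \<Omega> p f c l =
     ennreal_sqrt (average (cube c l) (\<lambda>x. (norm (f x - heat_semigroup \<Omega> p (l\<^sup>2) f x))\<^sup>2))"

definition VMO ::
    "(real^'n) set \<Rightarrow> (real \<Rightarrow> real^'n \<Rightarrow> real^'n \<Rightarrow> real) \<Rightarrow> (real^'n \<Rightarrow> complex) set" where
  "VMO \<Omega> p = {f \<in> BMO \<Omega> p.
     ((\<lambda>r. SUP (c, l) \<in> {(c, l) \<in> cubes_in \<Omega>. l \<le> r}. osc \<Omega> p f c l) \<longlongrightarrow> 0) (at_right 0)
   \<and> ((\<lambda>r. SUP (c, l) \<in> {(c, l) \<in> cubes_in \<Omega>. l \<ge> r}. osc \<Omega> p f c l) \<longlongrightarrow> 0) at_top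
   \<and> ((\<lambda>r. SUP (c, l) \<in> cubes_in (\<Omega> \<inter> - cube 0 r). osc \<Omega> p f c l) \<longlongrightarrow> 0) at_top}"

abbreviation "VMO_norm \<equiv> BMO_norm"

end

theory Submission
  imports Defs
begin

text \<open>
  Because of the factor \<open>H(x\<^sub>n y\<^sub>n)\<close> in its kernel, the whole-space semigroup does not let the two
  half-spaces interact: on each of them, \<open>f - e\<^bsup>-t\<Delta>\<^esup> f\<close> is the corresponding expression for the
  restriction of \<open>f\<close> (\<open>heat_semigroup_half_space\<close>).  Cubes inside a half-space therefore have the
  same oscillation in both settings.  Since they form a subfamily of all cubes, every supremum for
  a half-space is at most the one for the whole space.

  For the converse inequalities, only a cube \<open>Q\<close> that crosses the hyperplane \<open>x\<^sub>n = 0\<close> needs an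
  argument.  Slide \<open>Q\<close> in the direction \<open>x\<^sub>n\<close>, once up and once down, until it just touches the
  hyperplane from one side.  The two cubes so obtained lie in the two half-spaces and cover \<open>Q\<close> up
  to the hyperplane, a null set; and they have the side length of \<open>Q\<close>, hence the same volume and,
  what is essential, the same heat time \<open>\<ell>(Q)\<^sup>2\<close>.  So the average over \<open>Q\<close> is at most the sum of the
  two averages, and the same holds for their square roots.  If \<open>Q\<close> misses the cube \<open>Q(0,r)\<close>, so do
  the two translates, because \<open>Q\<close> and \<open>Q(0,r)\<close> both cross the hyperplane and must already be
  separated by one of the other coordinates (\<open>cubes_in_split\<close>).  The three vanishing conditions
  thus pass to the whole space by \<open>cube_sup_le_half_spaces\<close>, and the norms satisfy
  \<open>(\<parallel>f\<^sub>+\<parallel> + \<parallel>f\<^sub>-\<parallel>) / 2 \<le> \<parallel>f\<parallel> \<le> \<parallel>f\<^sub>+\<parallel> + \<parallel>f\<^sub>-\<parallel>\<close>.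
\<close>

section \<open>Integrals without measurability\<close>

text \<open>
  A nonnegative integral is a supremum over simple functions below the integrand, and a simple
  function below \<open>g\<close> on \<open>A \<union> B\<close> is at most the sum of its parts on \<open>A\<close> and \<open>B\<close>.  So \<open>g\<close> may be
  arbitrary, and the measurability of \<open>e\<^bsup>-tL\<^esup> f\<close> in the space variable never has to be established.
\<close>
lemma set_nn_integral_Un_le:
  assumes [measurable]: "A \<in> sets M" "B \<in> sets M"
  shows "(\<integral>\<^sup>+x\<in>A \<union> B. g x \<partial>M) \<le> (\<integral>\<^sup>+x\<in>A. g x \<partial>M) + (\<integral>\<^sup>+x\<in>B. g x \<partial>M)"
  unfolding nn_integral_def[of M "\<lambda>x. g x * indicator (A \<union> B) x"]
proof (rule SUP_least, safe)
  fix s assume s[measurable]: "simple_function M s" and le: "s \<le> (\<lambda>x. g x * indicator (A \<union> B) x)"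
  have s_meas[measurable]: "s \<in> borel_measurable M"
    by (rule borel_measurable_simple_function[OF s])
  have le': "s x \<le> g x * indicator (A \<union> B) x" for x
    using le by (simp add: le_fun_def)
  have "integral\<^sup>S M s = (\<integral>\<^sup>+x. s x \<partial>M)"
    by (simp add: nn_integral_eq_simple_integral s)
  also have "\<dots> \<le> (\<integral>\<^sup>+x. s x * indicator A x + s x * indicator B x \<partial>M)"
  proof (rule nn_integral_mono)
    fix x show "s x \<le> s x * indicator A x + s x * indicator B x"
      using le'[of x] by (auto split: split_indicator)
  qed
  also have "\<dots> = (\<integral>\<^sup>+x\<in>A. s x \<partial>M) + (\<integral>\<^sup>+x\<in>B. s x \<partial>M)"
    by (rule nn_integral_add) measurable
  also have "\<dots> \<le> (\<integral>\<^sup>+x\<in>A. g x \<partial>M) + (\<integral>\<^sup>+x\<in>B. g x \<partial>M)"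
  proof (intro add_mono nn_integral_mono)
    fix x
    show "s x * indicator A x \<le> g x * indicator A x" "s x * indicator B x \<le> g x * indicator B x"
      using le'[of x] by (auto split: split_indicator)
  qed
  finally show "integral\<^sup>S M s \<le> (\<integral>\<^sup>+x\<in>A. g x \<partial>M) + (\<integral>\<^sup>+x\<in>B. g x \<partial>M)" .
qed

text \<open>
  Lebesgue measure is complete, so functions that agree almost everywhere are both measurable or
  both not; in the second case both integrals are \<open>0\<close> by convention.
\<close>
lemma lebesgue_integral_cong_AE_complete:
  fixes f g :: "'a::euclidean_space \<Rightarrow> 'b::euclidean_space"
  assumes "AE x in lebesgue. f x = g x"
  shows "integral\<^sup>L lebesgue f = integral\<^sup>L lebesgue g"
proof (cases "f \<in> borel_measurable lebesgue")
  case True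
  then show ?thesis
    using assms borel_measurable_AE[OF True assms] by (intro integral_cong_AE)
next
  case False
  have "AE x in lebesgue. g x = f x"
    using assms by eventually_elim simp
  then have "g \<notin> borel_measurable lebesgue"
    using False borel_measurable_AE by blast
  with False show ?thesis
    by (metis borel_measurable_integrable not_integrable_integral_eq)
qed

section \<open>Localization to a half-space\<close>

lemma AE_off_hyperplane: "AE y in lebesgue. (y :: real^'n::finite) $ k \<noteq> 0"
proof -
  have "negligible {y :: real^'n. axis k 1 \<bullet> y = 0}"
    by (rule negligible_hyperplane) simp
  then have "{y :: real^'n. y $ k = 0} \<in> null_sets lebesgue"
    by (simp add: negligible_iff_null_sets inner_axis')
  from AE_not_in[OF this] show ?thesis by simp
qed

text \<open>
  For \<open>x\<close> in a half-space and \<open>y\<close> off the hyperplane, \<open>H(x\<^sub>n y\<^sub>n) = 1\<close> exactly when \<open>y\<close> lies in the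
  same half-space.
\<close>
lemma heat_semigroup_half_space:
  fixes k :: "'n::finite"
  assumes H: "H = upper_half k \<or> H = lower_half k" and x: "x \<in> H"
  shows "heat_semigroup UNIV (neumann_kernel k) t f x
       = heat_semigroup H (neumann_half_kernel k) t (restrict f H) x"
  unfolding heat_semigroup_def set_lebesgue_integral_def
proof (rule lebesgue_integral_cong_AE_complete)
  show "AE y in lebesgue. indicat_real UNIV y *\<^sub>R neumann_kernel k t x y *\<^sub>R f y
      = indicat_real H y *\<^sub>R neumann_half_kernel k t x y *\<^sub>R restrict f H y"
    using AE_off_hyperplane[of k]
  proof eventually_elim
    fix y :: "real^'n" assume y: "y $ k \<noteq> 0"
    have "heaviside (x $ k * y $ k) = indicator H y"
      using H x y
      by (auto simp: heaviside_def upper_half_def lower_half_def zero_le_mult_iff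
          split: split_indicator)
    then show "indicat_real UNIV y *\<^sub>R neumann_kernel k t x y *\<^sub>R f y
      = indicat_real H y *\<^sub>R neumann_half_kernel k t x y *\<^sub>R restrict f H y"
      by (auto simp: neumann_kernel_def split: split_indicator)
  qed
qed

lemma M_space_restrict:
  assumes f: "f \<in> M_space UNIV"
  shows "restrict f H \<in> M_space H"
proof -
  have "set_integrable lebesgue K (restrict f H)" if K: "compact K" "K \<subseteq> H" for K
  proof -
    have "set_integrable lebesgue K f"
      using f K by (auto simp: M_space_def L1_loc_def)
    moreover have "(\<lambda>x. indicat_real K x *\<^sub>R restrict f H x) = (\<lambda>x. indicat_real K x *\<^sub>R f x)"
      using K by (intro ext) (auto split: split_indicator)
    ultimately show ?thesis
      by (simp add: set_integrable_def)
  qed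
  moreover obtain \<epsilon> where "\<epsilon> > 0" and \<epsilon>: "(\<integral>\<^sup>+x\<in>UNIV. ennreal ((norm (f x))\<^sup>2 / (1 + norm x powr (real CARD('a) + \<epsilon>))) \<partial>lebesgue) < \<infinity>"
    using f by (auto simp: M_space_def)
  moreover have "(\<integral>\<^sup>+x\<in>H. ennreal ((norm (restrict f H x))\<^sup>2 / (1 + norm x powr (real CARD('a) + \<epsilon>))) \<partial>lebesgue)
     \<le> (\<integral>\<^sup>+x\<in>UNIV. ennreal ((norm (f x))\<^sup>2 / (1 + norm x powr (real CARD('a) + \<epsilon>))) \<partial>lebesgue)"
    by (intro nn_integral_mono) (auto split: split_indicator)
  ultimately show ?thesis
    unfolding M_space_def L1_loc_def by (auto intro: order_le_less_trans)
qed

lemma average_cong: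
  assumes "\<And>x. x \<in> Q \<Longrightarrow> g x = h x"
  shows "average Q g = average Q h"
proof -
  have "(\<integral>\<^sup>+x\<in>Q. ennreal (g x) \<partial>lebesgue) = (\<integral>\<^sup>+x\<in>Q. ennreal (h x) \<partial>lebesgue)"
    by (intro nn_integral_cong) (auto simp: assms split: split_indicator)
  then show ?thesis by (simp add: average_def)
qed

text \<open>
  The function \<open>\<phi>\<close> is the norm in the BMO norm and the squared norm in the oscillation.
\<close>
lemma average_half_space:
  fixes k :: "'n::finite"
  assumes H: "H = upper_half k \<or> H = lower_half k" and Q: "Q \<subseteq> H"
  shows "average Q (\<lambda>x. \<phi> (f x - heat_semigroup UNIV (neumann_kernel k) t f x))
       = average Q (\<lambda>x. \<phi> (restrict f H x
            - heat_semigroup H (neumann_half_kernel k) t (restrict f H) x))"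
proof (rule average_cong)
  fix x assume "x \<in> Q"
  then have "x \<in> H" using Q by blast
  then show "\<phi> (f x - heat_semigroup UNIV (neumann_kernel k) t f x)
      = \<phi> (restrict f H x - heat_semigroup H (neumann_half_kernel k) t (restrict f H) x)"
    by (simp add: heat_semigroup_half_space[OF H])
qed

lemma osc_half_space:
  fixes k :: "'n::finite"
  assumes "H = upper_half k \<or> H = lower_half k" and "cube c l \<subseteq> H"
  shows "osc UNIV (neumann_kernel k) f c l = osc H (neumann_half_kernel k) (restrict f H) c l"
  unfolding osc_def average_half_space[OF assms, where \<phi> = "\<lambda>z. (norm z)\<^sup>2"] ..

section \<open>Cubes that cross the hyperplane\<close>

definition with_coord :: "'n::finite \<Rightarrow> real \<Rightarrow> real^'n \<Rightarrow> real^'n" where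
  "with_coord k s x = (\<chi> i. if i = k then s else x $ i)"

lemma with_coord_nth [simp]: "with_coord k s x $ i = (if i = k then s else x $ i)"
  by (simp add: with_coord_def)

lemma cube_translation: "cube c l = (\<lambda>x. 1 *\<^sub>R x + c) ` cube 0 l"
proof -
  have "x \<in> (\<lambda>x. 1 *\<^sub>R x + c) ` cube 0 l" if "x \<in> cube c l" for x
    using that by (intro image_eqI[of _ _ "x - c"]) (auto simp: cube_def)
  then show ?thesis by (auto simp: cube_def)
qed

lemma emeasure_cube_centre:
  fixes a b :: "real^'n::finite"
  shows "emeasure lebesgue (cube a l) = emeasure lebesgue (cube b l)"
proof -
  have "emeasure lebesgue (cube c l) = emeasure lebesgue (cube (0 :: real^'n) l)" for c :: "real^'n"
    by (subst cube_translation, subst emeasure_lebesgue_affine) simp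
  from this[of a] this[of b] show ?thesis by simp
qed

lemma cube_sets [measurable]: "cube c l \<in> sets lebesgue"
proof -
  have "cube c l = box (c - (\<chi> i. l/2)) (c + (\<chi> i. l/2))"
    by (simp only: set_eq_iff cube_def mem_box_cart mem_Collect_eq abs_diff_less_iff) simp
  then show ?thesis by simp
qed

text \<open>
  All three cubes have the same volume, so only the integrals have to be compared.
\<close>
lemma average_cube_le_add:
  fixes k :: "'n::finite"
  assumes cover: "cube c l \<subseteq> cube a l \<union> cube b l \<union> {x. x $ k = 0}"
  shows "average (cube c l) g \<le> average (cube a l) g + average (cube b l) g"
proof -
  let ?I = "\<lambda>Q. \<integral>\<^sup>+x\<in>Q. ennreal (g x) \<partial>lebesgue"
  have "?I (cube c l) \<le> ?I (cube a l \<union> cube b l)"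
  proof (rule nn_integral_mono_AE)
    show "AE x in lebesgue. ennreal (g x) * indicator (cube c l) x
        \<le> ennreal (g x) * indicator (cube a l \<union> cube b l) x"
      using AE_off_hyperplane[of k]
    proof eventually_elim
      fix x :: "real^'n" assume "x $ k \<noteq> 0"
      then have "x \<in> cube c l \<longrightarrow> x \<in> cube a l \<or> x \<in> cube b l"
        using cover by blast
      then show "ennreal (g x) * indicator (cube c l) x
          \<le> ennreal (g x) * indicator (cube a l \<union> cube b l) x"
        by (auto split: split_indicator)
    qed
  qed
  also have "\<dots> \<le> ?I (cube a l) + ?I (cube b l)"
    by (intro set_nn_integral_Un_le cube_sets)
  finally show ?thesis
    unfolding average_def emeasure_cube_centre[of a l c] emeasure_cube_centre[of b l c]
    by (subst add_divide_distrib_ennreal[symmetric]) (rule divide_right_mono_ennreal)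
qed

text \<open>
  In the crossing case the two cubes have the centre of the given one, with the distinguished
  coordinate changed to \<open>l/2\<close> and \<open>- l/2\<close>.  The set \<open>- cube 0 r\<close> covers both the cubes far from the
  origin and, with \<open>r = 0\<close>, all cubes.
\<close>
lemma cubes_in_split:
  fixes k :: "'n::finite" and r :: real
  assumes cl: "(c, l) \<in> cubes_in (- cube 0 r)"
  obtains (upper) "(c, l) \<in> cubes_in (upper_half k \<inter> - cube 0 r)"
    | (lower) "(c, l) \<in> cubes_in (lower_half k \<inter> - cube 0 r)"
    | (crossing) a b where "(a, l) \<in> cubes_in (upper_half k \<inter> - cube 0 r)"
        "(b, l) \<in> cubes_in (lower_half k \<inter> - cube 0 r)"
        "cube c l \<subseteq> cube a l \<union> cube b l \<union> {x. x $ k = 0}"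
proof -
  have l: "l > 0" and off: "cube c l \<subseteq> - cube 0 r"
    using cl by (auto simp: cubes_in_def)
  have coord_k: "c $ k - l/2 < x $ k \<and> x $ k < c $ k + l/2" if "x \<in> cube c l" for x
    using that unfolding cube_def abs_diff_less_iff by blast
  consider "c $ k \<ge> l/2" | "c $ k \<le> - l/2" | "\<bar>c $ k\<bar> < l/2"
    by linarith
  then show thesis
  proof cases
    case 1
    then have "cube c l \<subseteq> upper_half k"
      using coord_k by (force simp: upper_half_def)
    with l off upper show thesis by (auto simp: cubes_in_def)
  next
    case 2
    then have "cube c l \<subseteq> lower_half k"
      using coord_k by (force simp: lower_half_def)
    with l off lower show thesis by (auto simp: cubes_in_def)
  next
    case 3
    define a where "a = with_coord k (l/2) c"
    define b where "b = with_coord k (- l/2) c"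
    have nth_k: "\<bar>t - l/2\<bar> < l/2 \<longleftrightarrow> 0 < t \<and> t < l" "\<bar>t - (- l/2)\<bar> < l/2 \<longleftrightarrow> - l < t \<and> t < 0" for t :: real
      unfolding abs_diff_less_iff by auto
    have cube_with_coord: "x \<in> cube (with_coord k s c) l \<longleftrightarrow>
        (\<forall>i. i \<noteq> k \<longrightarrow> \<bar>x $ i - c $ i\<bar> < l/2) \<and> \<bar>x $ k - s\<bar> < l/2" for x s
      by (auto simp: cube_def)
    have a: "x \<in> cube a l \<longleftrightarrow> (\<forall>i. i \<noteq> k \<longrightarrow> \<bar>x $ i - c $ i\<bar> < l/2) \<and> 0 < x $ k \<and> x $ k < l" for x
      by (simp only: a_def cube_with_coord nth_k)
    have b: "x \<in> cube b l \<longleftrightarrow> (\<forall>i. i \<noteq> k \<longrightarrow> \<bar>x $ i - c $ i\<bar> < l/2) \<and> - l < x $ k \<and> x $ k < 0" for x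
      by (simp only: b_def cube_with_coord nth_k)
    \<comment> \<open>A common point of a translate and \<open>cube 0 r\<close> can be moved onto the hyperplane without
      leaving \<open>cube 0 r\<close>; it then lies in the crossing cube as well.\<close>
    have disjoint: "x \<notin> cube 0 r" if x: "\<forall>i. i \<noteq> k \<longrightarrow> \<bar>x $ i - c $ i\<bar> < l/2" for x
    proof
      assume xr: "x \<in> cube 0 r"
      then have "\<bar>x $ k - 0\<bar> < r/2" by (simp add: cube_def)
      then have "r > 0" by linarith
      with xr have "with_coord k 0 x \<in> cube 0 r" by (auto simp: cube_def)
      moreover have "with_coord k 0 x \<in> cube c l" using x 3 by (auto simp: cube_def)
      ultimately show False using off by blast
    qed
    have "(a, l) \<in> cubes_in (upper_half k \<inter> - cube 0 r)"
      using l disjoint by (auto simp: cubes_in_def a upper_half_def)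
    moreover have "(b, l) \<in> cubes_in (lower_half k \<inter> - cube 0 r)"
      using l disjoint by (auto simp: cubes_in_def b lower_half_def)
    moreover have "cube c l \<subseteq> cube a l \<union> cube b l \<union> {x. x $ k = 0}"
    proof
      fix x assume x: "x \<in> cube c l"
      from coord_k[OF x] 3 have "- l < x $ k" "x $ k < l" by linarith+
      with x show "x \<in> cube a l \<union> cube b l \<union> {x. x $ k = 0}"
        unfolding Un_iff a b by (auto simp: cube_def)
    qed
    ultimately show thesis by (rule crossing)
  qed
qed

section \<open>Suprema over cubes\<close>

text \<open>
  The BMO norm and the three suprema in the vanishing conditions have this common form: \<open>P\<close>
  restricts the side length, \<open>r\<close> the position, and \<open>r = 0\<close> means no restriction because \<open>cube 0 0\<close>
  is empty.
\<close>
definition cube_sup ::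
    "(real^'n) set \<Rightarrow> (real^'n \<Rightarrow> real \<Rightarrow> ennreal) \<Rightarrow> real \<Rightarrow> (real \<Rightarrow> bool) \<Rightarrow> ennreal" where
  "cube_sup \<Omega> F r P = (SUP (c, l) \<in> {(c, l) \<in> cubes_in (\<Omega> \<inter> - cube 0 r). P l}. F c l)"

lemma cube_sup_upper:
  assumes "(c, l) \<in> cubes_in (\<Omega> \<inter> - cube 0 r)" "P l"
  shows "F c l \<le> cube_sup \<Omega> F r P"
  unfolding cube_sup_def using assms by (intro SUP_upper2[of "(c, l)"]) auto

lemma cube_sup_least:
  assumes "\<And>c l. (c, l) \<in> cubes_in (\<Omega> \<inter> - cube 0 r) \<Longrightarrow> P l \<Longrightarrow> F c l \<le> z"
  shows "cube_sup \<Omega> F r P \<le> z"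
  unfolding cube_sup_def using assms by (intro SUP_least) auto

lemma cube_sup_half_space_le:
  fixes F G :: "real^'n::finite \<Rightarrow> real \<Rightarrow> ennreal"
  assumes local: "\<And>c l. cube c l \<subseteq> H \<Longrightarrow> F c l = G c l"
  shows "cube_sup H G r P \<le> cube_sup UNIV F r P"
proof (rule cube_sup_least)
  fix c l assume cl: "(c, l) \<in> cubes_in (H \<inter> - cube 0 r)" "P l"
  then have "G c l = F c l"
    by (auto simp: cubes_in_def local)
  also have "\<dots> \<le> cube_sup UNIV F r P"
    using cl by (intro cube_sup_upper) (auto simp: cubes_in_def)
  finally show "G c l \<le> cube_sup UNIV F r P" .
qed

text \<open>
  The hypothesis \<open>crossing\<close> compares cubes of one side length only.  This suits averages whose
  integrand depends on the cube through the heat time \<open>l\<^sup>2\<close>, and their square roots.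
\<close>
lemma cube_sup_le_half_spaces:
  fixes k :: "'n::finite"
  assumes upper: "\<And>c l. cube c l \<subseteq> upper_half k \<Longrightarrow> F c l = Fu c l"
    and lower: "\<And>c l. cube c l \<subseteq> lower_half k \<Longrightarrow> F c l = Fl c l"
    and crossing: "\<And>a b c l. cube c l \<subseteq> cube a l \<union> cube b l \<union> {x. x $ k = 0}
        \<Longrightarrow> F c l \<le> F a l + F b l"
  shows "cube_sup UNIV F r P \<le> cube_sup (upper_half k) Fu r P + cube_sup (lower_half k) Fl r P"
proof (rule cube_sup_least)
  fix c :: "real^'n" and l :: real
  assume "(c, l) \<in> cubes_in (UNIV \<inter> - cube 0 r)" and P: "P l"
  then have cl: "(c, l) \<in> cubes_in (- cube 0 r)" by simp
  have u: "F a l \<le> cube_sup (upper_half k) Fu r P"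
    if "(a, l) \<in> cubes_in (upper_half k \<inter> - cube 0 r)" for a
    using that cube_sup_upper[OF that, of P Fu] P upper[of a l] by (auto simp: cubes_in_def)
  have w: "F b l \<le> cube_sup (lower_half k) Fl r P"
    if "(b, l) \<in> cubes_in (lower_half k \<inter> - cube 0 r)" for b
    using that cube_sup_upper[OF that, of P Fl] P lower[of b l] by (auto simp: cubes_in_def)
  from cl show "F c l \<le> cube_sup (upper_half k) Fu r P + cube_sup (lower_half k) Fl r P"
  proof (cases rule: cubes_in_split[where k = k])
    case upper
    then show ?thesis by (intro add_increasing2[OF zero_le] u)
  next
    case lower
    then show ?thesis by (intro add_increasing[OF zero_le] w)
  next
    case (crossing a b)
    have "F c l \<le> F a l + F b l"
      by (rule assms(3)) fact
    also have "\<dots> \<le> cube_sup (upper_half k) Fu r P + cube_sup (lower_half k) Fl r P"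
      by (intro add_mono u w crossing)
    finally show ?thesis .
  qed
qed

section \<open>Norm and oscillation on the two half-spaces\<close>

lemma ennreal_sqrt_simps [simp]:
  "ennreal_sqrt top = top" "0 \<le> s \<Longrightarrow> ennreal_sqrt (ennreal s) = ennreal (sqrt s)"
  by (simp_all add: ennreal_sqrt_def)

lemma ennreal_sqrt_mono: "a \<le> b \<Longrightarrow> ennreal_sqrt a \<le> ennreal_sqrt b"
  by (cases a; cases b) (simp_all add: ennreal_leI top_unique)

lemma ennreal_sqrt_add_le: "ennreal_sqrt (a + b) \<le> ennreal_sqrt a + ennreal_sqrt b"
proof (cases a; cases b)
  fix s t :: real
  assume "0 \<le> s" "a = ennreal s" "0 \<le> t" "b = ennreal t"
  then show ?thesis
    by (simp add: sqrt_add_le_add_sqrt ennreal_leI flip: ennreal_plus)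
qed simp_all

lemma osc_cube_le_add:
  fixes k :: "'n::finite"
  assumes "cube c l \<subseteq> cube a l \<union> cube b l \<union> {x. x $ k = 0}"
  shows "osc \<Omega> p f c l \<le> osc \<Omega> p f a l + osc \<Omega> p f b l"
  unfolding osc_def
  by (rule order_trans[OF ennreal_sqrt_mono[OF average_cube_le_add[OF assms]] ennreal_sqrt_add_le])

lemma cube_0_0 [simp]: "cube 0 0 = {}"
  by (auto simp: cube_def)

lemma BMO_norm_eq_cube_sup:
  "BMO_norm \<Omega> p f = cube_sup \<Omega>
     (\<lambda>c l. average (cube c l) (\<lambda>x. norm (f x - heat_semigroup \<Omega> p (l\<^sup>2) f x))) 0 (\<lambda>_. True)"
  by (simp add: BMO_norm_def cube_sup_def)

lemma VMO_iff:
  "f \<in> VMO \<Omega> p \<longleftrightarrow> f \<in> BMO \<Omega> p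
     \<and> ((\<lambda>r. cube_sup \<Omega> (osc \<Omega> p f) 0 (\<lambda>l. l \<le> r)) \<longlongrightarrow> 0) (at_right 0)
     \<and> ((\<lambda>r. cube_sup \<Omega> (osc \<Omega> p f) 0 (\<lambda>l. l \<ge> r)) \<longlongrightarrow> 0) at_top
     \<and> ((\<lambda>r. cube_sup \<Omega> (osc \<Omega> p f) r (\<lambda>_. True)) \<longlongrightarrow> 0) at_top"
  by (simp add: VMO_def cube_sup_def)

lemma BMO_norm_half_space_le:
  fixes k :: "'n::finite"
  assumes "H = upper_half k \<or> H = lower_half k"
  shows "BMO_norm H (neumann_half_kernel k) (restrict f H) \<le> BMO_norm UNIV (neumann_kernel k) f"
  unfolding BMO_norm_eq_cube_sup
  by (rule cube_sup_half_space_le) (rule average_half_space[OF assms, where \<phi> = norm])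

lemma BMO_norm_le_half_spaces:
  fixes k :: "'n::finite"
  shows "BMO_norm UNIV (neumann_kernel k) f
     \<le> BMO_norm (upper_half k) (neumann_half_kernel k) (restrict f (upper_half k))
      + BMO_norm (lower_half k) (neumann_half_kernel k) (restrict f (lower_half k))"
  unfolding BMO_norm_eq_cube_sup
proof (rule cube_sup_le_half_spaces)
  fix a b c :: "real^'n" and l :: real
  assume "cube c l \<subseteq> cube a l \<union> cube b l \<union> {x. x $ k = 0}"
  then show "average (cube c l) (\<lambda>x. norm (f x - heat_semigroup UNIV (neumann_kernel k) (l\<^sup>2) f x))
    \<le> average (cube a l) (\<lambda>x. norm (f x - heat_semigroup UNIV (neumann_kernel k) (l\<^sup>2) f x))
     + average (cube b l) (\<lambda>x. norm (f x - heat_semigroup UNIV (neumann_kernel k) (l\<^sup>2) f x))"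
    by (rule average_cube_le_add)
qed (rule average_half_space[where \<phi> = norm]; simp)+

lemma osc_sup_half_space_le:
  fixes k :: "'n::finite"
  assumes "H = upper_half k \<or> H = lower_half k"
  shows "cube_sup H (osc H (neumann_half_kernel k) (restrict f H)) r P
     \<le> cube_sup UNIV (osc UNIV (neumann_kernel k) f) r P"
  by (rule cube_sup_half_space_le) (rule osc_half_space[OF assms])

lemma osc_sup_le_half_spaces:
  fixes k :: "'n::finite"
  shows "cube_sup UNIV (osc UNIV (neumann_kernel k) f) r P
     \<le> cube_sup (upper_half k)
          (osc (upper_half k) (neumann_half_kernel k) (restrict f (upper_half k))) r P
      + cube_sup (lower_half k)
          (osc (lower_half k) (neumann_half_kernel k) (restrict f (lower_half k))) r P"
  by (rule cube_sup_le_half_spaces; (rule osc_half_space osc_cube_le_add; simp))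

lemma tendsto_0_le_ennreal:
  fixes g :: "real \<Rightarrow> ennreal"
  assumes "(g \<longlongrightarrow> 0) F" and "\<And>r. h r \<le> g r"
  shows "(h \<longlongrightarrow> 0) F"
  using assms by (intro tendsto_sandwich[of "\<lambda>_. 0" h F g]) auto

section \<open>The decomposition of VMO\<close>

lemma restrict_VMO_half_space:
  fixes k :: "'n::finite"
  assumes f: "f \<in> VMO UNIV (neumann_kernel k)"
    and H: "H = upper_half k \<or> H = lower_half k"
  shows "restrict f H \<in> VMO H (neumann_half_kernel k)"
  using f M_space_restrict[of f H] order_le_less_trans[OF BMO_norm_half_space_le[OF H]]
  unfolding VMO_iff BMO_def
  by (auto intro: tendsto_0_le_ennreal[OF _ osc_sup_half_space_le[OF H]])

lemma VMO_from_half_spaces: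
  fixes k :: "'n::finite"
  assumes f: "f \<in> M_space UNIV"
    and u: "restrict f (upper_half k) \<in> VMO (upper_half k) (neumann_half_kernel k)"
    and w: "restrict f (lower_half k) \<in> VMO (lower_half k) (neumann_half_kernel k)"
  shows "f \<in> VMO UNIV (neumann_kernel k)"
proof -
  have lim: "((\<lambda>r. cube_sup UNIV (osc UNIV (neumann_kernel k) f) (\<rho> r) (P r)) \<longlongrightarrow> 0) F"
    if "((\<lambda>r. cube_sup (upper_half k)
          (osc (upper_half k) (neumann_half_kernel k) (restrict f (upper_half k))) (\<rho> r) (P r)) \<longlongrightarrow> 0) F"
      "((\<lambda>r. cube_sup (lower_half k)
          (osc (lower_half k) (neumann_half_kernel k) (restrict f (lower_half k))) (\<rho> r) (P r)) \<longlongrightarrow> 0) F"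
    for \<rho> :: "real \<Rightarrow> real" and P F
    using tendsto_add[OF that]
    by (intro tendsto_0_le_ennreal[OF _ osc_sup_le_half_spaces]) simp
  have "BMO_norm UNIV (neumann_kernel k) f < \<infinity>"
    using u w by (intro order_le_less_trans[OF BMO_norm_le_half_spaces]) (auto simp: VMO_iff BMO_def)
  with f u w show ?thesis
    unfolding VMO_iff BMO_def by (auto intro: lim)
qed

theorem theorem3p3:
  fixes k :: "'n::finite"
  shows "VMO UNIV (neumann_kernel k) =
      {f \<in> M_space UNIV.
         restrict f (upper_half k) \<in> VMO (upper_half k) (neumann_half_kernel k) \<and>
         restrict f (lower_half k) \<in> VMO (lower_half k) (neumann_half_kernel k)}
    \<and> (\<exists>c>0. \<exists>C>0. \<forall>f \<in> VMO UNIV (neumann_kernel k).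
         ennreal c * (VMO_norm (upper_half k) (neumann_half_kernel k) (restrict f (upper_half k))
                    + VMO_norm (lower_half k) (neumann_half_kernel k) (restrict f (lower_half k)))
           \<le> VMO_norm UNIV (neumann_kernel k) f
       \<and> VMO_norm UNIV (neumann_kernel k) f
           \<le> ennreal C * (VMO_norm (upper_half k) (neumann_half_kernel k) (restrict f (upper_half k))
                    + VMO_norm (lower_half k) (neumann_half_kernel k) (restrict f (lower_half k))))"
proof (rule conjI; ((rule exI[of _ "1/2"], rule conjI, simp, rule exI[of _ 1], intro conjI ballI)?))
  show "VMO UNIV (neumann_kernel k) =
      {f \<in> M_space UNIV.
         restrict f (upper_half k) \<in> VMO (upper_half k) (neumann_half_kernel k) \<and>
         restrict f (lower_half k) \<in> VMO (lower_half k) (neumann_half_kernel k)}"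
  proof (intro set_eqI iffI)
    fix f assume f: "f \<in> VMO UNIV (neumann_kernel k)"
    then have "f \<in> M_space UNIV" by (simp add: VMO_def BMO_def)
    with f show "f \<in> {f \<in> M_space UNIV.
         restrict f (upper_half k) \<in> VMO (upper_half k) (neumann_half_kernel k) \<and>
         restrict f (lower_half k) \<in> VMO (lower_half k) (neumann_half_kernel k)}"
      by (simp add: restrict_VMO_half_space)
  qed (simp add: VMO_from_half_spaces)
next
  fix f
  let ?N = "VMO_norm UNIV (neumann_kernel k) f"
  let ?U = "VMO_norm (upper_half k) (neumann_half_kernel k) (restrict f (upper_half k))"
  let ?L = "VMO_norm (lower_half k) (neumann_half_kernel k) (restrict f (lower_half k))"
  have "?U + ?L \<le> 2 * ?N"
    using add_mono[OF BMO_norm_half_space_le[of "upper_half k" k f]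
        BMO_norm_half_space_le[of "lower_half k" k f]] by (simp add: mult_2)
  then have "ennreal (1/2) * (?U + ?L) \<le> ennreal (1/2) * (2 * ?N)"
    by (rule mult_left_mono) simp
  also have "\<dots> = ?N"
  proof -
    have "ennreal (1/2) * ennreal 2 = 1"
      by (subst ennreal_mult[symmetric]) simp_all
    then have "ennreal (1/2) * 2 = 1" by (simp only: ennreal_numeral)
    then show ?thesis by (simp only: mult.assoc[symmetric] mult_1)
  qed
  finally show "ennreal (1/2) * (?U + ?L) \<le> ?N" .
  show "?N \<le> ennreal 1 * (?U + ?L)"
    by (simp add: BMO_norm_le_half_spaces)
qed auto

end
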